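(* Let $F$ be a field, $L$ a separable field extension of $F$, $\sigma\in\mathrm{Aut}(L/F)$ a nontrivial automorphism, and $\eta,\mu\in L$ with $\eta\neq0$. Suppose that either $\sigma^2\neq\mathrm{Id}$ or $\mu\neq0$. Then: (i) $L$ is equal to the middle nucleus and to the right nucleus of $Kn_2(L,\sigma,\eta,\mu)$ but is not contained in the left nucleus. (ii) $L$ is equal to the left nucleus and to the right nucleus of $Kn_3(L,\sigma,\eta,\mu)$ but is not contained in the middle nucleus. (iii) $L$ is equal to the left nucleus and to the middle nucleus of $HK(L,\sigma,\eta,\mu)$ but is not contained in the right nucleus. (iv) $L$ is not contained in any of the left, right or middle nuclei of $Kn_1(L,\sigma,\eta,\mu)$.
   Context: The algebras $Kn_1,Kn_2,Kn_3,HK$ with parameters $(L,\sigma,\eta,\mu)$ are the $F$-vector space $L\oplus L$ with the respective multiplications (for $x,y,u,v\in L$): $Kn_1$: $(x,y)(u,v)=(xu+\eta\sigma(v)\sigma^{-2}(y),\ vx+y\sigma(u)+\mu\sigma(v)\sigma^{-1}(y))$; $Kn_2$: $(x,y)(u,v)=(xu+\eta\sigma^{-1}(v)\sigma^{-2}(y),\ vx+y\sigma(u)+\mu v\sigma^{-1}(y))$; $Kn_3$: $(x,y)(u,v)=(xu+\eta\sigma^{-1}(v)y,\ vx+y\sigma(u)+\mu vy)$; $HK$: $(x,y)(u,v)=(xu+\eta\sigma(v)y,\ vx+y\sigma(u)+\mu\sigma(v)y)$. Each is a unital $F$-algebra with unit $(1,0)$, and $L$ is identified with the subalgebra $L\oplus0$.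 With associator $[x,y,z]=(xy)z-x(yz)$, the left (respectively middle, right) nucleus of an algebra $A$ is the set of $w\in A$ with $[w,y,z]=0$ (respectively $[y,w,z]=0$, $[y,z,w]=0$) for all $y,z\in A$. *)

theory Defs
  imports
    "HOL-Library.Product_Plus"
    "HOL-Computational_Algebra.Polynomial"
    "HOL-Algebra.Algebraic_Closure_Type"
begin

text \<open>A field extension is given by its embedding, a homomorphism of fields from the base
  field \<open>F = 'f\<close> into \<open>L = 'l\<close>; injectivity is automatic.\<close>

definition field_extension :: "('f::field \<Rightarrow> 'l::field) \<Rightarrow> bool" where
  "field_extension \<iota> \<longleftrightarrow>
     \<iota> 1 = 1 \<and> (\<forall>a b. \<iota> (a + b) = \<iota> a + \<iota> b) \<and> (\<forall>a b. \<iota> (a * b) = \<iota> a * \<iota> b)"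

text \<open>A minimal polynomial over \<open>F\<close> is a monic irreducible polynomial having the element as a
  root; an element without one is transcendental. The qualified names avoid the homonymous
  constants of \<open>HOL-Algebra\<close>.\<close>

definition is_min_poly :: "('f::field \<Rightarrow> 'l::field) \<Rightarrow> 'l \<Rightarrow> 'f poly \<Rightarrow> bool" where
  "is_min_poly \<iota> x p \<longleftrightarrow>
     Factorial_Ring.irreducible p \<and> Polynomial.coeff p (Polynomial.degree p) = 1 \<and>
     poly (map_poly \<iota> p) x = 0"

text \<open>\<open>rsquarefree\<close> over the algebraic closure: all roots there are simple.\<close>

definition separable_poly :: "'f::field poly \<Rightarrow> bool" where
  "separable_poly p \<longleftrightarrow> rsquarefree (map_poly to_ac p)"

definition separable_extension :: "('f::field \<Rightarrow> 'l::field) \<Rightarrow> bool" where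
  "separable_extension \<iota> \<longleftrightarrow>
     field_extension \<iota> \<and> (\<forall>x. \<exists>p. is_min_poly \<iota> x p \<and> separable_poly p)"

definition Aut :: "('f::field \<Rightarrow> 'l::field) \<Rightarrow> ('l \<Rightarrow> 'l) set" where
  "Aut \<iota> = {\<sigma>. bij \<sigma> \<and>
     (\<forall>x y. \<sigma> (x + y) = \<sigma> x + \<sigma> y) \<and> (\<forall>x y. \<sigma> (x * y) = \<sigma> x * \<sigma> y) \<and>
     (\<forall>a. \<sigma> (\<iota> a) = \<iota> a)}"

text \<open>A not necessarily associative algebra is given by its multiplication on an additive group.\<close>

definition associator :: "('a \<Rightarrow> 'a \<Rightarrow> 'a::ab_group_add) \<Rightarrow> 'a \<Rightarrow> 'a \<Rightarrow> 'a \<Rightarrow> 'a" where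
  "associator m x y z = m (m x y) z - m x (m y z)"

definition left_nucleus :: "('a \<Rightarrow> 'a \<Rightarrow> 'a::ab_group_add) \<Rightarrow> 'a set" where
  "left_nucleus m = {w. \<forall>y z. associator m w y z = 0}"

definition middle_nucleus :: "('a \<Rightarrow> 'a \<Rightarrow> 'a::ab_group_add) \<Rightarrow> 'a set" where
  "middle_nucleus m = {w. \<forall>y z. associator m y w z = 0}"

definition right_nucleus :: "('a \<Rightarrow> 'a \<Rightarrow> 'a::ab_group_add) \<Rightarrow> 'a set" where
  "right_nucleus m = {w. \<forall>y z. associator m y z w = 0}"

text \<open>The multiplications on \<open>L \<oplus> L\<close>, whose additive structure is the componentwise one of
  \<open>Product_Plus\<close>. The qualified \<open>Hilbert_Choice.inv\<close> is the inverse function, as opposed to the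
  inverse in a group of \<open>HOL-Algebra\<close>.\<close>

definition Kn1 :: "('l::field \<Rightarrow> 'l) \<Rightarrow> 'l \<Rightarrow> 'l \<Rightarrow> 'l \<times> 'l \<Rightarrow> 'l \<times> 'l \<Rightarrow> 'l \<times> 'l" where
  "Kn1 \<sigma> \<eta> \<mu> = (\<lambda>(x, y) (u, v). let \<tau> = Hilbert_Choice.inv \<sigma> in
     (x * u + \<eta> * \<sigma> v * \<tau> (\<tau> y), v * x + y * \<sigma> u + \<mu> * \<sigma> v * \<tau> y))"

definition Kn2 :: "('l::field \<Rightarrow> 'l) \<Rightarrow> 'l \<Rightarrow> 'l \<Rightarrow> 'l \<times> 'l \<Rightarrow> 'l \<times> 'l \<Rightarrow> 'l \<times> 'l" where
  "Kn2 \<sigma> \<eta> \<mu> = (\<lambda>(x, y) (u, v). let \<tau> = Hilbert_Choice.inv \<sigma> in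
     (x * u + \<eta> * \<tau> v * \<tau> (\<tau> y), v * x + y * \<sigma> u + \<mu> * v * \<tau> y))"

definition Kn3 :: "('l::field \<Rightarrow> 'l) \<Rightarrow> 'l \<Rightarrow> 'l \<Rightarrow> 'l \<times> 'l \<Rightarrow> 'l \<times> 'l \<Rightarrow> 'l \<times> 'l" where
  "Kn3 \<sigma> \<eta> \<mu> = (\<lambda>(x, y) (u, v). let \<tau> = Hilbert_Choice.inv \<sigma> in
     (x * u + \<eta> * \<tau> v * y, v * x + y * \<sigma> u + \<mu> * v * y))"

definition HK :: "('l::field \<Rightarrow> 'l) \<Rightarrow> 'l \<Rightarrow> 'l \<Rightarrow> 'l \<times> 'l \<Rightarrow> 'l \<times> 'l \<Rightarrow> 'l \<times> 'l" where
  "HK \<sigma> \<eta> \<mu> = (\<lambda>(x, y) (u, v).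
     (x * u + \<eta> * \<sigma> v * y, v * x + y * \<sigma> u + \<mu> * \<sigma> v * y))"

text \<open>The copy \<open>L \<oplus> 0\<close> of \<open>L\<close>.\<close>

definition embedded_L :: "('l::field \<times> 'l) set" where
  "embedded_L = {(x, 0) | x. True}"

end

theory Submission
  imports Defs
begin

text \<open>All four multiplications have the shape
  \<open>(x, y)(u, v) = (xu + \<eta>\<alpha>(v)\<beta>(y), vx + y\<sigma>(u) + \<mu>\<gamma>(v)\<delta>(y))\<close>. An associator with one argument in \<open>L\<close> factors,
  in each coordinate, into \<open>\<eta>\<alpha>(v)\<beta>(y)\<close> or \<open>\<mu>\<gamma>(v)\<delta>(y)\<close> times a difference depending only on that
  argument. So containment of \<open>L\<close> in a nucleus is an identity between \<open>\<sigma>, \<alpha>, \<beta>, \<gamma>, \<delta>\<close>; and an element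
  of \<open>L\<close> violating it for one nucleus forces the second coordinate of every member of the other
  two nuclei to vanish.\<close>

definition twisted_mult ::
    "('l::field \<Rightarrow> 'l) \<Rightarrow> ('l \<Rightarrow> 'l) \<Rightarrow> ('l \<Rightarrow> 'l) \<Rightarrow> ('l \<Rightarrow> 'l) \<Rightarrow> ('l \<Rightarrow> 'l) \<Rightarrow> 'l \<Rightarrow> 'l \<Rightarrow>
      'l \<times> 'l \<Rightarrow> 'l \<times> 'l \<Rightarrow> 'l \<times> 'l" where
  "twisted_mult \<sigma> \<alpha> \<beta> \<gamma> \<delta> \<eta> \<mu> = (\<lambda>(x, y) (u, v).
     (x * u + \<eta> * \<alpha> v * \<beta> y, v * x + y * \<sigma> u + \<mu> * \<gamma> v * \<delta> y))"

text \<open>\<open>field_extension\<close> is the predicate of a unital homomorphism of fields, so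
  it also serves for endomorphisms of \<open>L\<close> such as \<sigma>, its inverse and the
  identity.\<close>

lemma field_extension_1: "field_extension f \<Longrightarrow> f 1 = 1"
  and field_extension_add: "field_extension f \<Longrightarrow> f (a + b) = f a + f b"
  and field_extension_mult: "field_extension f \<Longrightarrow> f (a * b) = f a * f b"
  by (auto simp: field_extension_def)

lemma field_extension_0: "field_extension f \<Longrightarrow> f 0 = 0"
  by (metis add.right_neutral add_left_cancel field_extension_add)

text \<open>A nonzero \<open>a\<close> has \<open>f a * f (inverse a) = 1\<close>. This injectivity
  is what allows cancelling the twisted factors of an associator.\<close>

lemma field_extension_eq_0_iff: "field_extension f \<Longrightarrow> f a = 0 \<longleftrightarrow> a = 0"
  by (metis field_extension_0 field_extension_1 field_extension_mult mult_zero_left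
      right_inverse zero_neq_one)

lemma field_extension_id: "field_extension (id :: 'l::field \<Rightarrow> 'l)"
  by (simp add: field_extension_def)

lemma field_extension_comp:
  "field_extension f \<Longrightarrow> field_extension g \<Longrightarrow> field_extension (f \<circ> g)"
  by (simp add: field_extension_def)

lemma field_extension_inv:
  assumes f: "field_extension f" and b: "bij f"
  shows "field_extension (Hilbert_Choice.inv f)"
proof -
  have [simp]: "f (Hilbert_Choice.inv f x) = x" for x
    using b by (simp add: bij_is_surj surj_f_inv_f)
  \<comment> \<open>By injectivity, each law for the inverse may be checked after applying
    \<open>f\<close>, where it becomes a law of \<open>f\<close>.\<close>
  have eqI: "Hilbert_Choice.inv f x = y" if "x = f y" for x y
    using b that by (simp add: bij_is_inj)
  show ?thesis
    unfolding field_extension_def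
    by (intro conjI allI; rule eqI)
      (simp_all add: field_extension_1[OF f] field_extension_add[OF f] field_extension_mult[OF f])
qed

lemma Aut_bij: "\<sigma> \<in> Aut \<iota> \<Longrightarrow> bij \<sigma>"
  by (simp add: Aut_def)

text \<open>The unit law is not among the clauses of \<open>Aut\<close>; it follows because \<sigma>
  fixes \<open>\<iota> 1 = 1\<close>.\<close>

lemma Aut_field_extension:
  assumes "field_extension \<iota>" "\<sigma> \<in> Aut \<iota>"
  shows "field_extension \<sigma>"
proof -
  have "\<sigma> (\<iota> 1) = \<iota> 1"
    using assms by (simp add: Aut_def)
  with assms show ?thesis
    by (simp add: Aut_def field_extension_def)
qed

text \<open>No relation between the five maps is assumed: relations between them will emerge as the
  exact conditions for \<open>L\<close> to lie in a nucleus.\<close>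

locale twisted_algebra =
  fixes \<sigma> \<alpha> \<beta> \<gamma> \<delta> :: "'l::field \<Rightarrow> 'l" and \<eta> \<mu> :: 'l
  assumes sigma: "field_extension \<sigma>"
    and alpha: "field_extension \<alpha>"
    and beta: "field_extension \<beta>"
    and gamma: "field_extension \<gamma>"
    and delta: "field_extension \<delta>"
    and eta: "\<eta> \<noteq> 0"
begin

abbreviation "m \<equiv> twisted_mult \<sigma> \<alpha> \<beta> \<gamma> \<delta> \<eta> \<mu>"

lemmas hom_simps =
  sigma[THEN field_extension_0] sigma[THEN field_extension_1]
  sigma[THEN field_extension_add] sigma[THEN field_extension_mult]
  alpha[THEN field_extension_0] alpha[THEN field_extension_1]
  alpha[THEN field_extension_add] alpha[THEN field_extension_mult]
  beta[THEN field_extension_0] beta[THEN field_extension_1]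
  beta[THEN field_extension_add] beta[THEN field_extension_mult]
  gamma[THEN field_extension_0] gamma[THEN field_extension_1]
  gamma[THEN field_extension_add] gamma[THEN field_extension_mult]
  delta[THEN field_extension_0] delta[THEN field_extension_1]
  delta[THEN field_extension_add] delta[THEN field_extension_mult]

lemmas hom_eq_0 =
  alpha[THEN field_extension_eq_0_iff] beta[THEN field_extension_eq_0_iff]
  gamma[THEN field_extension_eq_0_iff] delta[THEN field_extension_eq_0_iff]

text \<open>Multiplying by \<open>(l, 0)\<close> from the left scales both coordinates by
  \<open>l\<close>; from the right it scales them by \<open>l\<close> and \<open>\<sigma> l\<close>.
  The terms without \<eta> and \<mu> cancel in all three associators.\<close>

lemma associator_left:
  "associator m (l, 0) (x, y) (u, v) =
     (\<eta> * \<alpha> v * \<beta> y * (\<beta> l - l), \<mu> * \<gamma> v * \<delta> y * (\<delta> l - l))"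
  by (simp add: associator_def twisted_mult_def hom_simps algebra_simps)

lemma associator_middle:
  "associator m (x, y) (l, 0) (u, v) =
     (\<eta> * \<alpha> v * \<beta> y * (\<beta> (\<sigma> l) - \<alpha> l), \<mu> * \<gamma> v * \<delta> y * (\<delta> (\<sigma> l) - \<gamma> l))"
  by (simp add: associator_def twisted_mult_def hom_simps algebra_simps)

lemma associator_right:
  "associator m (x, y) (u, v) (l, 0) =
     (\<eta> * \<alpha> v * \<beta> y * (l - \<alpha> (\<sigma> l)), \<mu> * \<gamma> v * \<delta> y * (\<sigma> l - \<gamma> (\<sigma> l)))"
  by (simp add: associator_def twisted_mult_def hom_simps algebra_simps)

text \<open>As \<eta> and the images of nonzero \<open>v\<close> and \<open>y\<close> are nonzero,
  only the last factor matters. The second coordinate also vanishes when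
  \<open>\<mu> = 0\<close>.\<close>

lemma associator_left_eq_0_iff:
  "associator m (l, 0) (x, y) (u, v) = 0 \<longleftrightarrow>
     v = 0 \<or> y = 0 \<or> \<beta> l = l \<and> (\<mu> = 0 \<or> \<delta> l = l)"
  by (auto simp: associator_left zero_prod_def hom_eq_0 eta)

lemma associator_middle_eq_0_iff:
  "associator m (x, y) (l, 0) (u, v) = 0 \<longleftrightarrow>
     v = 0 \<or> y = 0 \<or> \<beta> (\<sigma> l) = \<alpha> l \<and> (\<mu> = 0 \<or> \<delta> (\<sigma> l) = \<gamma> l)"
  by (auto simp: associator_middle zero_prod_def hom_eq_0 eta)

lemma associator_right_eq_0_iff:
  "associator m (x, y) (u, v) (l, 0) = 0 \<longleftrightarrow>
     v = 0 \<or> y = 0 \<or> l = \<alpha> (\<sigma> l) \<and> (\<mu> = 0 \<or> \<sigma> l = \<gamma> (\<sigma> l))"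
  by (auto simp: associator_right zero_prod_def hom_eq_0 eta)

lemma embedded_L_in_left_iff:
  "embedded_L \<subseteq> left_nucleus m \<longleftrightarrow> (\<forall>l. \<beta> l = l \<and> (\<mu> = 0 \<or> \<delta> l = l))"
  by (auto simp: embedded_L_def left_nucleus_def associator_left_eq_0_iff subset_iff)
    \<comment> \<open>Taking \<open>y = v = 1\<close> excludes the two degenerate
      alternatives.\<close>
    (metis zero_neq_one)+

lemma embedded_L_in_middle_iff:
  "embedded_L \<subseteq> middle_nucleus m \<longleftrightarrow>
     (\<forall>l. \<beta> (\<sigma> l) = \<alpha> l \<and> (\<mu> = 0 \<or> \<delta> (\<sigma> l) = \<gamma> l))"
  by (auto simp: embedded_L_def middle_nucleus_def associator_middle_eq_0_iff subset_iff)
    (metis zero_neq_one)+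

lemma embedded_L_in_right_iff:
  "embedded_L \<subseteq> right_nucleus m \<longleftrightarrow>
     (\<forall>l. l = \<alpha> (\<sigma> l) \<and> (\<mu> = 0 \<or> \<sigma> l = \<gamma> (\<sigma> l)))"
  by (auto simp: embedded_L_def right_nucleus_def associator_right_eq_0_iff subset_iff)
    (metis zero_neq_one)+

text \<open>The vanishing criterion is read backwards: with a violating \<open>l\<close> in the
  first slot, the associator vanishes only if one of the other two arguments has second coordinate
  0.\<close>

lemma nuclei_in_L_if_not_left:
  assumes "\<not> embedded_L \<subseteq> left_nucleus m"
  shows "middle_nucleus m \<subseteq> embedded_L" "right_nucleus m \<subseteq> embedded_L"
proof -
  obtain l where l: "\<not> (\<beta> l = l \<and> (\<mu> = 0 \<or> \<delta> l = l))"
    using assms embedded_L_in_left_iff by auto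
  have "b = 0" if "(a, b) \<in> middle_nucleus m" for a b
  proof -
    \<comment> \<open>The filler \<open>(0, 1)\<close> has nonzero second coordinate, which leaves
      \<open>b = 0\<close>.\<close>
    have "associator m (l, 0) (a, b) (0, 1) = 0"
      using that by (simp add: middle_nucleus_def)
    with l show ?thesis by (auto simp: associator_left_eq_0_iff)
  qed
  then show "middle_nucleus m \<subseteq> embedded_L" by (auto simp: embedded_L_def)
  have "b = 0" if "(a, b) \<in> right_nucleus m" for a b
  proof -
    have "associator m (l, 0) (0, 1) (a, b) = 0"
      using that by (simp add: right_nucleus_def)
    with l show ?thesis by (auto simp: associator_left_eq_0_iff)
  qed
  then show "right_nucleus m \<subseteq> embedded_L" by (auto simp: embedded_L_def)
qed

lemma nuclei_in_L_if_not_middle: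
  assumes "\<not> embedded_L \<subseteq> middle_nucleus m"
  shows "left_nucleus m \<subseteq> embedded_L" "right_nucleus m \<subseteq> embedded_L"
proof -
  obtain l where l: "\<not> (\<beta> (\<sigma> l) = \<alpha> l \<and> (\<mu> = 0 \<or> \<delta> (\<sigma> l) = \<gamma> l))"
    using assms embedded_L_in_middle_iff by auto
  have "b = 0" if "(a, b) \<in> left_nucleus m" for a b
  proof -
    have "associator m (a, b) (l, 0) (0, 1) = 0"
      using that by (simp add: left_nucleus_def)
    with l show ?thesis by (auto simp: associator_middle_eq_0_iff)
  qed
  then show "left_nucleus m \<subseteq> embedded_L" by (auto simp: embedded_L_def)
  have "b = 0" if "(a, b) \<in> right_nucleus m" for a b
  proof -
    have "associator m (0, 1) (l, 0) (a, b) = 0"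
      using that by (simp add: right_nucleus_def)
    with l show ?thesis by (auto simp: associator_middle_eq_0_iff)
  qed
  then show "right_nucleus m \<subseteq> embedded_L" by (auto simp: embedded_L_def)
qed

lemma nuclei_in_L_if_not_right:
  assumes "\<not> embedded_L \<subseteq> right_nucleus m"
  shows "left_nucleus m \<subseteq> embedded_L" "middle_nucleus m \<subseteq> embedded_L"
proof -
  obtain l where l: "\<not> (l = \<alpha> (\<sigma> l) \<and> (\<mu> = 0 \<or> \<sigma> l = \<gamma> (\<sigma> l)))"
    using assms embedded_L_in_right_iff by auto
  have "b = 0" if "(a, b) \<in> left_nucleus m" for a b
  proof -
    have "associator m (a, b) (0, 1) (l, 0) = 0"
      using that by (simp add: left_nucleus_def)
    with l show ?thesis unfolding associator_right_eq_0_iff by auto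
  qed
  then show "left_nucleus m \<subseteq> embedded_L" by (auto simp: embedded_L_def)
  have "b = 0" if "(a, b) \<in> middle_nucleus m" for a b
  proof -
    have "associator m (0, 1) (a, b) (l, 0) = 0"
      using that by (simp add: middle_nucleus_def)
    with l show ?thesis unfolding associator_right_eq_0_iff by auto
  qed
  then show "middle_nucleus m \<subseteq> embedded_L" by (auto simp: embedded_L_def)
qed

end

lemma Kn1_eq_twisted_mult:
  "Kn1 \<sigma> \<eta> \<mu> = twisted_mult \<sigma> \<sigma> (Hilbert_Choice.inv \<sigma> \<circ> Hilbert_Choice.inv \<sigma>)
     \<sigma> (Hilbert_Choice.inv \<sigma>) \<eta> \<mu>"
  by (simp add: Kn1_def twisted_mult_def Let_def)

lemma Kn2_eq_twisted_mult:
  "Kn2 \<sigma> \<eta> \<mu> = twisted_mult \<sigma> (Hilbert_Choice.inv \<sigma>)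
     (Hilbert_Choice.inv \<sigma> \<circ> Hilbert_Choice.inv \<sigma>) id (Hilbert_Choice.inv \<sigma>) \<eta> \<mu>"
  by (simp add: Kn2_def twisted_mult_def Let_def)

lemma Kn3_eq_twisted_mult:
  "Kn3 \<sigma> \<eta> \<mu> = twisted_mult \<sigma> (Hilbert_Choice.inv \<sigma>) id id id \<eta> \<mu>"
  by (simp add: Kn3_def twisted_mult_def Let_def)

lemma HK_eq_twisted_mult: "HK \<sigma> \<eta> \<mu> = twisted_mult \<sigma> \<sigma> id \<sigma> id \<eta> \<mu>"
  by (simp add: HK_def twisted_mult_def)

theorem proposition5p1:
  fixes \<iota> :: "'f::field \<Rightarrow> 'l::field"
    and \<sigma> :: "'l \<Rightarrow> 'l"
    and \<eta> \<mu> :: 'l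
  assumes "separable_extension \<iota>"
    and "\<sigma> \<in> Aut \<iota>"
    and "\<sigma> \<noteq> id"
    and "\<eta> \<noteq> 0"
    and "\<sigma> \<circ> \<sigma> \<noteq> id \<or> \<mu> \<noteq> 0"
  shows "(embedded_L = middle_nucleus (Kn2 \<sigma> \<eta> \<mu>) \<and>
          embedded_L = right_nucleus (Kn2 \<sigma> \<eta> \<mu>) \<and>
          \<not> embedded_L \<subseteq> left_nucleus (Kn2 \<sigma> \<eta> \<mu>)) \<and>
         (embedded_L = left_nucleus (Kn3 \<sigma> \<eta> \<mu>) \<and>
          embedded_L = right_nucleus (Kn3 \<sigma> \<eta> \<mu>) \<and>
          \<not> embedded_L \<subseteq> middle_nucleus (Kn3 \<sigma> \<eta> \<mu>)) \<and>
         (embedded_L = left_nucleus (HK \<sigma> \<eta> \<mu>) \<and>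
          embedded_L = middle_nucleus (HK \<sigma> \<eta> \<mu>) \<and>
          \<not> embedded_L \<subseteq> right_nucleus (HK \<sigma> \<eta> \<mu>)) \<and>
         (\<not> embedded_L \<subseteq> left_nucleus (Kn1 \<sigma> \<eta> \<mu>) \<and>
          \<not> embedded_L \<subseteq> right_nucleus (Kn1 \<sigma> \<eta> \<mu>) \<and>
          \<not> embedded_L \<subseteq> middle_nucleus (Kn1 \<sigma> \<eta> \<mu>))"
proof -
  define \<tau> where "\<tau> = Hilbert_Choice.inv \<sigma>"
  have b: "bij \<sigma>"
    using assms(2) by (rule Aut_bij)
  have s: "field_extension \<sigma>"
    using assms(1,2) Aut_field_extension by (auto simp: separable_extension_def)
  have t: "field_extension \<tau>"
    unfolding \<tau>_def using s b by (rule field_extension_inv)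
  have \<tau>\<sigma> [simp]: "\<tau> (\<sigma> x) = x" and \<sigma>\<tau> [simp]: "\<sigma> (\<tau> x) = x" for x
    using b by (simp_all add: \<tau>_def bij_is_inj bij_is_surj surj_f_inv_f)
  \<comment> \<open>One witness covers both cases: an element moved by
    \<open>\<sigma> \<circ> \<sigma>\<close> if there is one, otherwise
    \<open>\<mu> \<noteq> 0\<close> and any element moved by \<sigma>.\<close>
  obtain l where l: "\<sigma> (\<sigma> l) \<noteq> l \<or> \<mu> \<noteq> 0 \<and> \<sigma> l \<noteq> l"
    using assms(3,5) by (auto simp: fun_eq_iff)
  interpret K1: twisted_algebra \<sigma> \<sigma> "\<tau> \<circ> \<tau>" \<sigma> \<tau> \<eta> \<mu>
    by unfold_locales (fact s t assms(4) field_extension_comp[OF t t])+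
  interpret K2: twisted_algebra \<sigma> \<tau> "\<tau> \<circ> \<tau>" id \<tau> \<eta> \<mu>
    by unfold_locales (fact s t assms(4) field_extension_comp[OF t t] field_extension_id)+
  interpret K3: twisted_algebra \<sigma> \<tau> id id id \<eta> \<mu>
    by unfold_locales (fact s t assms(4) field_extension_id)+
  interpret H: twisted_algebra \<sigma> \<sigma> id \<sigma> id \<eta> \<mu>
    by unfold_locales (fact s assms(4) field_extension_id)+
  \<comment> \<open>Up to applying \<sigma> or \<tau>, the three negated conditions all say that
    \<open>\<sigma> \<circ> \<sigma>\<close> is the identity and, unless \<open>\<mu> = 0\<close>,
    so is \<sigma>; \<open>l\<close> refutes this.\<close>
  have tau2: "\<not> (\<forall>x. \<tau> (\<tau> x) = x \<and> (\<mu> = 0 \<or> \<tau> x = x))"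
    using l by (metis \<tau>\<sigma>)
  have tau_sigma: "\<not> (\<forall>x. \<sigma> x = \<tau> x \<and> (\<mu> = 0 \<or> \<sigma> x = x))"
    using l by (metis \<sigma>\<tau>)
  have sigma2: "\<not> (\<forall>x. x = \<sigma> (\<sigma> x) \<and> (\<mu> = 0 \<or> \<sigma> x = \<sigma> (\<sigma> x)))"
    using l by metis
  have K1_left: "\<not> embedded_L \<subseteq> left_nucleus K1.m"
    using tau2 by (simp add: K1.embedded_L_in_left_iff)
  \<comment> \<open>Here \<open>\<beta> (\<sigma> x)\<close> is
    \<open>\<tau> (\<tau> (\<sigma> x)) = \<tau> x\<close>, to be compared with
    \<open>\<sigma> x\<close>, and \<open>\<delta> (\<sigma> x)\<close> is \<open>x\<close>.\<close>
  have K1_middle: "\<not> embedded_L \<subseteq> middle_nucleus K1.m"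
    using tau_sigma unfolding K1.embedded_L_in_middle_iff by (simp, metis)
  have K1_right: "\<not> embedded_L \<subseteq> right_nucleus K1.m"
    using sigma2 by (simp only: K1.embedded_L_in_right_iff not_False_eq_True)
  have K2_left: "\<not> embedded_L \<subseteq> left_nucleus K2.m"
    using tau2 by (simp add: K2.embedded_L_in_left_iff)
  \<comment> \<open>The twists match: \<open>\<beta> \<circ> \<sigma> = \<tau> = \<alpha>\<close>,
    \<open>\<delta> \<circ> \<sigma> = id = \<gamma>\<close> and
    \<open>\<alpha> \<circ> \<sigma> = id\<close>.\<close>
  have K2: "embedded_L \<subseteq> middle_nucleus K2.m" "embedded_L \<subseteq> right_nucleus K2.m"
    by (simp_all add: K2.embedded_L_in_middle_iff K2.embedded_L_in_right_iff)
  have K3_middle: "\<not> embedded_L \<subseteq> middle_nucleus K3.m"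
    using tau_sigma by (simp add: K3.embedded_L_in_middle_iff)
  have K3: "embedded_L \<subseteq> left_nucleus K3.m" "embedded_L \<subseteq> right_nucleus K3.m"
    by (simp_all add: K3.embedded_L_in_left_iff K3.embedded_L_in_right_iff)
  have H_right: "\<not> embedded_L \<subseteq> right_nucleus H.m"
    using sigma2 by (simp only: H.embedded_L_in_right_iff not_False_eq_True)
  have H: "embedded_L \<subseteq> left_nucleus H.m" "embedded_L \<subseteq> middle_nucleus H.m"
    by (simp_all add: H.embedded_L_in_left_iff H.embedded_L_in_middle_iff)
  \<comment> \<open>For \<open>Kn2\<close>, \<open>Kn3\<close> and \<open>HK\<close> the one nucleus
    not containing \<open>L\<close> supplies the reverse inclusions for the other two.\<close>
  show ?thesis
    unfolding Kn1_eq_twisted_mult Kn2_eq_twisted_mult Kn3_eq_twisted_mult HK_eq_twisted_mult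
      \<tau>_def[symmetric]
    using K1_left K1_middle K1_right
      K2_left K2 K2.nuclei_in_L_if_not_left[OF K2_left]
      K3_middle K3 K3.nuclei_in_L_if_not_middle[OF K3_middle]
      H_right H H.nuclei_in_L_if_not_right[OF H_right]
    by (intro conjI equalityI)
qed

end
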